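(* Let $a_1<1$ and $a_2<1$. Let $(u,v)$ be a nonnegative classical solution of the Neumann problem $$\begin{cases}\Delta[(d_1+a_{11}u)u]+u(1-u-a_1v)=0, & x\in\Omega,\\ \Delta[(d_2+a_{22}v)v]+v(1-a_2u-v)=0, & x\in\Omega,\\ \dfrac{\partial u}{\partial\nu}=\dfrac{\partial v}{\partial\nu}=0, & x\in\partial\Omega.\end{cases}$$ If $u\not\equiv0$ and $v\not\equiv0$, then $$u\equiv\frac{1-a_1}{1-a_1a_2}\quad\text{and}\quad v\equiv\frac{1-a_2}{1-a_1a_2}.$$
   Context: $\Omega\subset\mathbb{R}^n$ ($n\ge1$) is a bounded domain with smooth boundary satisfying the interior ball condition at every boundary point, and $\nu$ is the outward unit normal on $\partial\Omega$. The constants satisfy $a_1,a_2,d_1,d_2>0$ and $a_{11},a_{22}\ge0$. A nonnegative classical solution is a pair $(u,v)\in (C^1(\overline\Omega)\cap C^2(\Omega))^2$ with $u,v\ge0$ in $\overline\Omega$ satisfying the system (equations and boundary conditions) pointwise. *)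

theory Defs
  imports "HOL-Analysis.Analysis"
begin

definition partial_deriv :: "'a::euclidean_space \<Rightarrow> ('a \<Rightarrow> real) \<Rightarrow> 'a \<Rightarrow> real" where
  "partial_deriv b f x = frechet_derivative f (at x) b"

definition gradient :: "('a::euclidean_space \<Rightarrow> real) \<Rightarrow> 'a \<Rightarrow> 'a" where
  "gradient f x = (\<Sum>b\<in>Basis. partial_deriv b f x *\<^sub>R b)"

definition laplacian :: "('a::euclidean_space \<Rightarrow> real) \<Rightarrow> 'a \<Rightarrow> real" where
  "laplacian f x = (\<Sum>b\<in>Basis. partial_deriv b (partial_deriv b f) x)"

text \<open>The classes $C^k(S)$ and $C^\infty(S)$; they are meant for open \<open>S\<close> only, since
  \<^const>\<open>partial_deriv\<close> uses the derivative at \<open>x\<close> in the whole space.\<close>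

primrec Ck_on :: "nat \<Rightarrow> ('a::euclidean_space \<Rightarrow> real) \<Rightarrow> 'a set \<Rightarrow> bool" where
  "Ck_on 0 f S \<longleftrightarrow> continuous_on S f"
| "Ck_on (Suc k) f S \<longleftrightarrow>
     f differentiable_on S \<and> (\<forall>b\<in>Basis. Ck_on k (partial_deriv b f) S)"

definition Cinfinity_on :: "('a::euclidean_space \<Rightarrow> real) \<Rightarrow> 'a set \<Rightarrow> bool" where
  "Cinfinity_on f S \<longleftrightarrow> (\<forall>k. Ck_on k f S)"

text \<open>$C^1(\overline\Omega)$ for open \<open>\<Omega>\<close>: the first derivatives, defined in \<open>\<Omega>\<close>, extend
  continuously to the closure.\<close>

definition C1_closure :: "('a::euclidean_space \<Rightarrow> real) \<Rightarrow> 'a set \<Rightarrow> bool" where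
  "C1_closure f \<Omega> \<longleftrightarrow>
     continuous_on (closure \<Omega>) f \<and> Ck_on 1 f \<Omega> \<and>
     (\<exists>G. continuous_on (closure \<Omega>) G \<and> (\<forall>x\<in>\<Omega>. G x = gradient f x))"

text \<open>A smooth defining function of \<open>\<Omega>\<close> near the boundary point \<open>p\<close>, negative inside \<open>\<Omega>\<close>;
  its gradient therefore points out of \<open>\<Omega>\<close>.\<close>

definition local_defining_function ::
  "'a::euclidean_space set \<Rightarrow> 'a \<Rightarrow> 'a set \<Rightarrow> ('a \<Rightarrow> real) \<Rightarrow> bool" where
  "local_defining_function \<Omega> p U g \<longleftrightarrow>
     open U \<and> p \<in> U \<and> Cinfinity_on g U \<and> (\<forall>x\<in>U. gradient g x \<noteq> 0) \<and>
     \<Omega> \<inter> U = {x \<in> U. g x < 0} \<and> frontier \<Omega> \<inter> U = {x \<in> U. g x = 0}"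

definition smooth_boundary :: "'a::euclidean_space set \<Rightarrow> bool" where
  "smooth_boundary \<Omega> \<longleftrightarrow> (\<forall>p\<in>frontier \<Omega>. \<exists>U g. local_defining_function \<Omega> p U g)"

definition outward_unit_normal :: "'a::euclidean_space set \<Rightarrow> 'a \<Rightarrow> 'a \<Rightarrow> bool" where
  "outward_unit_normal \<Omega> p n \<longleftrightarrow>
     (\<exists>U g. local_defining_function \<Omega> p U g \<and> n = gradient g p /\<^sub>R norm (gradient g p))"

definition interior_ball_condition :: "'a::euclidean_space set \<Rightarrow> 'a \<Rightarrow> bool" where
  "interior_ball_condition \<Omega> p \<longleftrightarrow> (\<exists>c r. r > 0 \<and> ball c r \<subseteq> \<Omega> \<and> p \<in> sphere c r)"

definition bounded_smooth_domain :: "'a::euclidean_space set \<Rightarrow> bool" where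
  "bounded_smooth_domain \<Omega> \<longleftrightarrow>
     \<Omega> \<noteq> {} \<and> open \<Omega> \<and> connected \<Omega> \<and> bounded \<Omega> \<and> smooth_boundary \<Omega>"

text \<open>$\partial f/\partial\nu = \nu\cdot\nabla f$ at a boundary point \<open>p\<close>, where the value of
  $\nabla f$ at \<open>p\<close> is that of its continuous extension from \<open>\<Omega>\<close>; meaningful for \<open>f\<close> satisfying
  \<^const>\<open>C1_closure\<close>.\<close>

definition normal_deriv ::
  "'a::euclidean_space set \<Rightarrow> ('a \<Rightarrow> 'a) \<Rightarrow> ('a \<Rightarrow> real) \<Rightarrow> 'a \<Rightarrow> real" where
  "normal_deriv \<Omega> \<nu> f p = Lim (at p within \<Omega>) (gradient f) \<bullet> \<nu> p"

definition nonneg_classical_solution ::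
  "'a::euclidean_space set \<Rightarrow> ('a \<Rightarrow> 'a) \<Rightarrow> real \<Rightarrow> real \<Rightarrow> real \<Rightarrow> real \<Rightarrow> real \<Rightarrow> real
     \<Rightarrow> ('a \<Rightarrow> real) \<Rightarrow> ('a \<Rightarrow> real) \<Rightarrow> bool" where
  "nonneg_classical_solution \<Omega> \<nu> d\<^sub>1 d\<^sub>2 a\<^sub>1\<^sub>1 a\<^sub>2\<^sub>2 a\<^sub>1 a\<^sub>2 u v \<longleftrightarrow>
     C1_closure u \<Omega> \<and> Ck_on 2 u \<Omega> \<and> C1_closure v \<Omega> \<and> Ck_on 2 v \<Omega> \<and>
     (\<forall>x\<in>closure \<Omega>. u x \<ge> 0 \<and> v x \<ge> 0) \<and>
     (\<forall>x\<in>\<Omega>. laplacian (\<lambda>y. (d\<^sub>1 + a\<^sub>1\<^sub>1 * u y) * u y) x + u x * (1 - u x - a\<^sub>1 * v x) = 0) \<and>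
     (\<forall>x\<in>\<Omega>. laplacian (\<lambda>y. (d\<^sub>2 + a\<^sub>2\<^sub>2 * v y) * v y) x + v x * (1 - a\<^sub>2 * u x - v x) = 0) \<and>
     (\<forall>x\<in>frontier \<Omega>. normal_deriv \<Omega> \<nu> u x = 0 \<and> normal_deriv \<Omega> \<nu> v x = 0)"

end

theory Submission
  imports Defs
begin

text \<open>Each equation has the form \<open>\<Delta>W + u q = 0\<close> with \<open>W = (d + a u) u\<close> increasing in \<open>u \<ge> 0\<close>.
  By the Hopf boundary lemma and the Neumann condition, \<open>u\<close> is positive on the closure unless it
  vanishes identically, \<open>q \<ge> 0\<close> at a maximum of \<open>u\<close> (on the boundary or not) and \<open>q \<le> 0\<close> at a
  minimum. For the two species this gives \<open>max u \<le> 1 - a\<^sub>1 min v\<close>, \<open>min u \<ge> 1 - a\<^sub>1 max v\<close>,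
  \<open>max v \<le> 1 - a\<^sub>2 min u\<close> and \<open>min v \<ge> 1 - a\<^sub>2 max u\<close>; inserting the last inequality into the first
  bounds \<open>max u\<close> by the claimed constant, and the other two bound \<open>min u\<close> by it from below.\<close>

section \<open>Second-order calculus and the derivative test at a minimum\<close>

definition twice_diff_on :: "('a::euclidean_space \<Rightarrow> real) \<Rightarrow> 'a set \<Rightarrow> bool" where
  "twice_diff_on f S \<longleftrightarrow>
     (\<forall>x\<in>S. f differentiable (at x) \<and> (\<forall>b\<in>Basis. partial_deriv b f differentiable (at x)))"

lemma partial_deriv_eqI: "(f has_derivative D) (at x) \<Longrightarrow> partial_deriv b f x = D b"
  by (simp add: partial_deriv_def frechet_derivative_at[symmetric])

lemma has_derivative_partial_deriv:
  "f differentiable (at x) \<Longrightarrow> (f has_derivative (\<lambda>b. partial_deriv b f x)) (at x)"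
  using frechet_derivative_works[of f "at x"] by (simp add: partial_deriv_def)

lemma partial_deriv_inner_gradient:
  assumes "f differentiable (at x)"
  shows "partial_deriv y f x = gradient f x \<bullet> y"
proof -
  interpret bounded_linear "\<lambda>b. partial_deriv b f x"
    using has_derivative_bounded_linear[OF has_derivative_partial_deriv[OF assms]] .
  have "partial_deriv y f x = partial_deriv (\<Sum>b\<in>Basis. (y \<bullet> b) *\<^sub>R b) f x"
    by (simp add: euclidean_representation)
  also have "\<dots> = (\<Sum>b\<in>Basis. (y \<bullet> b) * partial_deriv b f x)"
    by (simp add: sum scaleR)
  also have "\<dots> = gradient f x \<bullet> y"
    unfolding gradient_def inner_sum_left
    by (rule sum.cong) (auto simp: inner_commute mult.commute)
  finally show ?thesis .
qed

lemma has_derivative_gradient: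
  "f differentiable (at x) \<Longrightarrow> (f has_derivative (\<lambda>h. gradient f x \<bullet> h)) (at x)"
  using has_derivative_partial_deriv[of f x] by (simp add: partial_deriv_inner_gradient)

lemma Ck_on_2_imp_twice_diff_on:
  assumes "Ck_on 2 f S" "open S"
  shows "twice_diff_on f S"
  using assms
  by (auto simp: twice_diff_on_def numeral_2_eq_2 differentiable_on_eq_differentiable_at)

lemma twice_diff_on_subset: "twice_diff_on f S \<Longrightarrow> T \<subseteq> S \<Longrightarrow> twice_diff_on f T"
  by (auto simp: twice_diff_on_def)

lemma has_real_derivative_along_line:
  assumes "(f has_derivative D) (at (x + t *\<^sub>R b))"
  shows "((\<lambda>t. f (x + t *\<^sub>R b)) has_real_derivative D b) (at t)"
proof -
  have "((\<lambda>t. f (x + t *\<^sub>R b)) has_derivative (\<lambda>h. D (h *\<^sub>R b))) (at t)"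
    by (rule has_derivative_compose[where f="\<lambda>t. x + t *\<^sub>R b" and g=f, OF _ assms])
       (auto intro!: derivative_eq_intros)
  moreover have "D (h *\<^sub>R b) = D b * h" for h
    using has_derivative_bounded_linear[OF assms]
    by (simp add: bounded_linear.linear linear_scale mult.commute)
  ultimately show ?thesis by (simp add: has_field_derivative_def)
qed

text \<open>Restricted to a coordinate line, the first derivative vanishes at the minimum. Were the
  second derivative negative, the first would be negative just to the right, and the mean value
  theorem would produce a value below the minimum.\<close>

lemma second_partial_nonneg_at_min:
  assumes S: "open S" "x \<in> S" and f: "twice_diff_on f S"
    and min: "\<And>y. y \<in> S \<Longrightarrow> f x \<le> f y" and b: "b \<in> Basis"
  shows "partial_deriv b (partial_deriv b f) x \<ge> 0"
proof (rule ccontr)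
  let ?g = "\<lambda>t. f (x + t *\<^sub>R b)" and ?g' = "\<lambda>t. partial_deriv b f (x + t *\<^sub>R b)"
  assume "\<not> ?thesis"
  then have neg: "partial_deriv b (partial_deriv b f) x < 0" by simp
  obtain e where e: "e > 0" "ball x e \<subseteq> S" using S open_contains_ball by blast
  have inS: "x + t *\<^sub>R b \<in> S" if "\<bar>t\<bar> < e" for t
    using e(2) that b by (auto simp: dist_norm subset_iff)
  have g: "(?g has_real_derivative ?g' t) (at t)" if "\<bar>t\<bar> < e" for t
    by (rule has_real_derivative_along_line, rule has_derivative_partial_deriv)
       (use f inS[OF that] in \<open>auto simp: twice_diff_on_def\<close>)
  have g': "(?g' has_real_derivative partial_deriv b (partial_deriv b f) x) (at 0)"
    by (rule has_real_derivative_along_line)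
       (use f S b has_derivative_partial_deriv in \<open>auto simp: twice_diff_on_def\<close>)
  have zero: "?g' 0 = 0"
    using DERIV_local_min[OF g[of 0] e(1)] min inS e(1) by auto
  obtain d where d: "d > 0" "\<And>h. h > 0 \<Longrightarrow> h < d \<Longrightarrow> ?g' h < 0"
    using DERIV_neg_dec_right[OF g' neg] zero by auto
  define h where "h = min d e / 2"
  have h: "h > 0" "h < d" "h < e" using d e by (auto simp: h_def)
  have "\<exists>z>0. z < h \<and> ?g h - ?g 0 = (h - 0) * ?g' z"
    by (rule MVT2) (use h g in auto)
  then obtain z where z: "z > 0" "z < h" "?g h - ?g 0 = h * ?g' z" by auto
  then have "?g h < ?g 0"
    using d(2)[of z] h mult_pos_neg[of h "?g' z"] by auto
  then show False using min[OF inS[of h]] h by auto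
qed

lemma laplacian_nonneg_at_min:
  assumes "open S" "x \<in> S" "twice_diff_on f S" "\<And>y. y \<in> S \<Longrightarrow> f x \<le> f y"
  shows "laplacian f x \<ge> 0"
  unfolding laplacian_def by (rule sum_nonneg) (rule second_partial_nonneg_at_min[OF assms])

text \<open>The Laplacian nests \<open>partial_deriv\<close>, so a formula for the inner derivative,
  valid on an open set, has to be rewritten under the outer one.\<close>

lemma partial_deriv_cong_open:
  assumes "open S" "x \<in> S" "\<And>y. y \<in> S \<Longrightarrow> f y = g y" and g: "g differentiable (at x)"
  shows "f differentiable (at x)" "partial_deriv b f x = partial_deriv b g x"
proof -
  have *: "(f has_derivative (\<lambda>b. partial_deriv b g x)) (at x)"
    by (rule has_derivative_transform_within_open[OF has_derivative_partial_deriv[OF g]])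
       (use assms in auto)
  then show "f differentiable (at x)" "partial_deriv b f x = partial_deriv b g x"
    by (auto simp: differentiable_def partial_deriv_eqI)
qed

lemma partial_deriv_lincomb:
  assumes "f differentiable (at x)" "g differentiable (at x)"
  shows "partial_deriv b (\<lambda>x. l + j * f x + k * g x) x = j * partial_deriv b f x + k * partial_deriv b g x"
  by (rule partial_deriv_eqI)
     (auto intro!: derivative_eq_intros has_derivative_partial_deriv assms)

text \<open>The shape \<open>l + j * f x + k * g x\<close> covers every auxiliary function below:
  the Hopf comparison function, the shift that makes a minimum value zero, and the sign change that
  turns a maximum into a minimum.\<close>

lemma twice_diff_on_lincomb:
  assumes S: "open S" and f: "twice_diff_on f S" and g: "twice_diff_on g S"
  shows "twice_diff_on (\<lambda>x. l + j * f x + k * g x) S"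
    and "x \<in> S \<Longrightarrow> laplacian (\<lambda>x. l + j * f x + k * g x) x = j * laplacian f x + k * laplacian g x"
proof -
  let ?F = "\<lambda>x. l + j * f x + k * g x"
  let ?G = "\<lambda>b x. 0 + j * partial_deriv b f x + k * partial_deriv b g x"
  have eq: "partial_deriv b ?F y = ?G b y" if "y \<in> S" for b y
    using partial_deriv_lincomb[of f y g b l j k] f g that by (auto simp: twice_diff_on_def)
  have G: "?G b differentiable (at y)" if "y \<in> S" "b \<in> Basis" for b y
    using f g that by (auto simp: twice_diff_on_def intro!: derivative_intros)
  show "twice_diff_on ?F S"
    unfolding twice_diff_on_def
  proof (intro ballI conjI)
    fix y b assume "y \<in> S" "b \<in> (Basis::'a set)"
    then show "partial_deriv b ?F differentiable at y"
      using partial_deriv_cong_open(1)[OF S _ eq G] by blast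
  qed (use f g in \<open>auto simp: twice_diff_on_def intro!: derivative_intros\<close>)
  assume x: "x \<in> S"
  have "partial_deriv b (partial_deriv b ?F) x =
      j * partial_deriv b (partial_deriv b f) x + k * partial_deriv b (partial_deriv b g) x"
    if b: "b \<in> Basis" for b
  proof -
    have "partial_deriv b (partial_deriv b ?F) x = partial_deriv b (?G b) x"
      by (rule partial_deriv_cong_open(2)[OF S x eq G[OF x b]])
    also have "\<dots> = j * partial_deriv b (partial_deriv b f) x + k * partial_deriv b (partial_deriv b g) x"
      by (rule partial_deriv_lincomb) (use f g x b in \<open>auto simp: twice_diff_on_def\<close>)
    finally show ?thesis .
  qed
  then show "laplacian ?F x = j * laplacian f x + k * laplacian g x"
    by (simp add: laplacian_def sum.distrib sum_distrib_left)
qed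

text \<open>Only regularity is recorded: the Laplacian of this quadratic expression is supplied by
  the differential equation itself.\<close>

lemma twice_diff_on_quadratic:
  assumes S: "open S" and u: "twice_diff_on u S"
  shows "twice_diff_on (\<lambda>x. (d + a * u x) * u x) S"
proof -
  let ?F = "\<lambda>x. (d + a * u x) * u x"
  let ?G = "\<lambda>b x. (d + 2 * a * u x) * partial_deriv b u x"
  have u1: "u differentiable at y" if "y \<in> S" for y
    using u that by (auto simp: twice_diff_on_def)
  have eq: "partial_deriv b ?F y = ?G b y" if "y \<in> S" for b y
    by (rule partial_deriv_eqI)
       (auto intro!: derivative_eq_intros has_derivative_partial_deriv u1 that simp: algebra_simps)
  have G: "?G b differentiable (at y)" if "y \<in> S" "b \<in> Basis" for b y
    using u that by (auto simp: twice_diff_on_def intro!: derivative_intros)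
  show ?thesis
    unfolding twice_diff_on_def
  proof (intro ballI conjI)
    fix y b assume "y \<in> S" "b \<in> (Basis::'a set)"
    then show "partial_deriv b ?F differentiable at y"
      using partial_deriv_cong_open(1)[OF S _ eq G] by blast
  qed (use u in \<open>auto simp: twice_diff_on_def intro!: derivative_intros\<close>)
qed

section \<open>Gaussian barrier and the Hopf boundary lemma\<close>

lemma gaussian:
  fixes c :: "'a::euclidean_space" and \<alpha> :: real
  defines "E \<equiv> \<lambda>x. exp (- \<alpha> * ((x - c) \<bullet> (x - c)))"
  shows "twice_diff_on E UNIV"
    and "laplacian E x = (4 * \<alpha>\<^sup>2 * (norm (x - c))\<^sup>2 - 2 * \<alpha> * DIM('a)) * E x"
proof -
  have E': "(E has_derivative (\<lambda>h. - 2 * \<alpha> * ((x - c) \<bullet> h) * E x)) (at x)" for x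
    unfolding E_def
    by (auto intro!: derivative_eq_intros simp: inner_commute algebra_simps)
  have eq: "partial_deriv b E = (\<lambda>x. - 2 * \<alpha> * ((x - c) \<bullet> b) * E x)" for b
    using partial_deriv_eqI[OF E'] by blast
  have E2: "(partial_deriv b E has_derivative
      (\<lambda>h. - 2 * \<alpha> * ((x - c) \<bullet> b) * (- 2 * \<alpha> * ((x - c) \<bullet> h) * E x) - 2 * \<alpha> * (h \<bullet> b) * E x)) (at x)"
    for b x
    unfolding eq by (auto intro!: derivative_eq_intros E' simp: algebra_simps)
  show "twice_diff_on E UNIV"
    unfolding twice_diff_on_def differentiable_def using E' E2 by blast
  have "laplacian E x = (\<Sum>b\<in>Basis. 4 * \<alpha>\<^sup>2 * E x * ((x - c) \<bullet> b)\<^sup>2 - 2 * \<alpha> * E x)"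
    unfolding laplacian_def
    by (rule sum.cong) (auto simp: partial_deriv_eqI[OF E2] power2_eq_square)
  also have "\<dots> = 4 * \<alpha>\<^sup>2 * E x * (\<Sum>b\<in>Basis. ((x - c) \<bullet> b)\<^sup>2) - 2 * \<alpha> * E x * DIM('a)"
    by (simp add: sum_subtractf sum_distrib_left)
  also have "(\<Sum>b\<in>Basis. ((x - c) \<bullet> b)\<^sup>2) = (norm (x - c))\<^sup>2"
    unfolding power2_norm_eq_inner euclidean_inner[of "x - c" "x - c"] by (simp add: power2_eq_square)
  finally show "laplacian E x = (4 * \<alpha>\<^sup>2 * (norm (x - c))\<^sup>2 - 2 * \<alpha> * DIM('a)) * E x"
    by (simp add: algebra_simps)
qed

text \<open>Comparison with the barrier \<open>m * (E x - R)\<close>, which vanishes on the sphere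
  and grows linearly along the radius from \<open>p\<close> to the centre. The weak inequality with
  \<open>K\<close> is what a bounded growth factor of either sign yields, and the linear lower bound
  replaces a derivative at the boundary point.\<close>

lemma hopf_lemma:
  fixes c p :: "'a::euclidean_space"
  assumes r: "r > 0" and p: "dist c p = r" and K: "K \<ge> 0"
    and cont: "continuous_on (cball c r) w" and w2: "twice_diff_on w (ball c r)"
    and nonneg: "\<And>x. x \<in> cball c r \<Longrightarrow> w x \<ge> 0" and pos: "\<And>x. x \<in> ball c r \<Longrightarrow> w x > 0"
    and super: "\<And>x. x \<in> ball c r \<Longrightarrow> laplacian w x \<le> K * w x"
  shows "\<exists>\<eta>>0. \<forall>t\<in>{0..1}. w (p + t *\<^sub>R (c - p)) \<ge> \<eta> * t"
proof -
  \<comment> \<open>This choice gives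
    \<open>\<alpha> * (\<alpha> * r\<^sup>2 - 2 * DIM('a)) > K\<close>, so the Laplacian of
    \<open>E\<close> exceeds \<open>K * E\<close> wherever the distance to \<open>c\<close> is at
    least \<open>r/2\<close>.\<close>
  define \<alpha> where "\<alpha> = max 1 ((2 * DIM('a) + K + 1) / r\<^sup>2)"
  define E where "E x = exp (- \<alpha> * ((x - c) \<bullet> (x - c)))" for x
  \<comment> \<open>The value of \<open>E\<close> on the sphere of radius \<open>r\<close>.\<close>
  define R where "R = exp (- \<alpha> * r\<^sup>2)"
  have E_norm: "E x = exp (- \<alpha> * (norm (x - c))\<^sup>2)" for x
    by (simp add: E_def power2_norm_eq_inner)
  have \<alpha>1: "\<alpha> \<ge> 1" by (simp add: \<alpha>_def)
  have "\<alpha> * r\<^sup>2 \<ge> (2 * DIM('a) + K + 1) / r\<^sup>2 * r\<^sup>2"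
    by (rule mult_right_mono) (auto simp: \<alpha>_def)
  then have "\<alpha> * r\<^sup>2 - 2 * DIM('a) \<ge> K + 1" using r by simp
  then have "\<alpha> * (\<alpha> * r\<^sup>2 - 2 * DIM('a)) \<ge> 1 * (K + 1)"
    by (intro mult_mono) (use \<alpha>1 K in auto)
  then have \<alpha>: "\<alpha>\<^sup>2 * r\<^sup>2 - 2 * \<alpha> * DIM('a) > K" by (simp add: power2_eq_square algebra_simps)
  have E2: "twice_diff_on E UNIV"
    and lapE: "laplacian E x = (4 * \<alpha>\<^sup>2 * (norm (x - c))\<^sup>2 - 2 * \<alpha> * DIM('a)) * E x" for x
    using gaussian[of \<alpha> c] unfolding E_def by auto
  \<comment> \<open>The barrier estimate fails near the centre; there the positive minimum
    \<open>m\<close> of \<open>w\<close> over the half-size ball takes over, since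
    \<open>E <= 1\<close> bounds the barrier by \<open>m\<close>.\<close>
  have "\<exists>x\<in>cball c (r/2). \<forall>y\<in>cball c (r/2). w x \<le> w y"
    by (rule continuous_attains_inf) (use r in \<open>auto intro: continuous_on_subset[OF cont]\<close>)
  then obtain x1 where x1: "x1 \<in> cball c (r/2)" "\<And>y. y \<in> cball c (r/2) \<Longrightarrow> w x1 \<le> w y"
    by blast
  define m where "m = w x1"
  have m: "m > 0" unfolding m_def using x1(1) r by (intro pos) auto
  define f where "f x = m * R + 1 * w x + (- m) * E x" for x
  have f2: "twice_diff_on f (ball c r)"
    and lapf: "x \<in> ball c r \<Longrightarrow> laplacian f x = 1 * laplacian w x + (- m) * laplacian E x" for x
    using twice_diff_on_lincomb[OF open_ball w2 twice_diff_on_subset[OF E2], where l="m * R" and j=1 and k="- m"]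
    unfolding f_def by auto
  have contE: "continuous_on A E" for A
    unfolding E_def by (intro continuous_intros)
  have "\<exists>x\<in>cball c r. \<forall>y\<in>cball c r. f x \<le> f y"
    by (rule continuous_attains_inf)
       (use r in \<open>auto simp: f_def intro!: continuous_intros cont contE\<close>)
  then obtain x0 where x0: "x0 \<in> cball c r" "\<And>y. y \<in> cball c r \<Longrightarrow> f x0 \<le> f y" by blast
  \<comment> \<open>A negative minimum of \<open>f\<close> cannot lie in the half-size ball, where
    \<open>w >= m\<close>, nor on the sphere, where the barrier is zero. In the annulus between them
    the Laplacian of \<open>f\<close> would be negative, against the derivative test.\<close>
  have "f x0 \<ge> 0"
  proof (rule ccontr)
    assume "\<not> f x0 \<ge> 0"
    then have neg: "f x0 < 0" by simp
    have 1: "x0 \<notin> cball c (r/2)"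
    proof
      assume "x0 \<in> cball c (r/2)"
      then have "w x0 \<ge> m" using x1(2) m_def by blast
      moreover have "m * E x0 \<le> m * 1"
        by (rule mult_left_mono) (use \<alpha>1 m in \<open>auto simp: E_def\<close>)
      moreover have "m * R > 0" using m by (simp add: R_def)
      ultimately show False using neg by (simp add: f_def)
    qed
    have 2: "dist c x0 \<noteq> r"
    proof
      assume "dist c x0 = r"
      then have "E x0 = R" by (simp add: E_norm R_def dist_norm norm_minus_commute)
      then show False using neg nonneg[OF x0(1)] by (simp add: f_def)
    qed
    have inb: "x0 \<in> ball c r" using 2 x0(1) by auto
    have "laplacian f x0 \<ge> 0"
      by (rule laplacian_nonneg_at_min[OF open_ball inb f2]) (use x0 in auto)
    moreover have "laplacian E x0 > K * (E x0 - R)"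
    proof -
      have "(r/2)\<^sup>2 \<le> (norm (x0 - c))\<^sup>2"
        using 1 r by (intro power_mono) (auto simp: dist_norm norm_minus_commute)
      then have "4 * \<alpha>\<^sup>2 * (r/2)\<^sup>2 \<le> 4 * \<alpha>\<^sup>2 * (norm (x0 - c))\<^sup>2"
        by (intro mult_left_mono) auto
      then have "K < 4 * \<alpha>\<^sup>2 * (norm (x0 - c))\<^sup>2 - 2 * \<alpha> * DIM('a)"
        using \<alpha> by (simp add: power2_eq_square)
      then have "K * E x0 < laplacian E x0"
        unfolding lapE by (rule mult_strict_right_mono) (simp add: E_def)
      moreover have "K * R \<ge> 0" using K by (simp add: R_def)
      ultimately show ?thesis by (simp add: algebra_simps)
    qed
    then have "m * laplacian E x0 > m * (K * (E x0 - R))"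
      using m by (rule mult_strict_left_mono)
    moreover have "K * f x0 \<le> 0" using neg K by (simp add: mult_nonneg_nonpos)
    ultimately show False
      using super[OF inb] lapf[OF inb] by (simp add: f_def algebra_simps)
  qed
  then have f0: "f y \<ge> 0" if "y \<in> cball c r" for y using x0(2)[OF that] by simp
  show ?thesis
  proof (intro exI conjI ballI)
    \<comment> \<open>The slope comes from
      \<open>E y = R * exp (\<alpha> * r\<^sup>2 * (2 * t - t\<^sup>2))\<close> together with
      \<open>exp z >= 1 + z\<close> and \<open>2 * t - t\<^sup>2 >= t\<close> on the unit
      interval.\<close>
    show "m * R * \<alpha> * r\<^sup>2 > 0" using m r \<alpha>1 by (simp add: R_def)
    fix t :: real assume t: "t \<in> {0..1}"
    define y where "y = p + t *\<^sub>R (c - p)"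
    have "y - c = (1 - t) *\<^sub>R (p - c)" by (simp add: y_def algebra_simps)
    then have ny: "norm (y - c) = (1 - t) * r"
      using t p by (simp add: dist_norm norm_minus_commute)
    then have "y \<in> cball c r"
      using t r by (simp add: dist_norm norm_minus_commute mult_le_cancel_right1)
    then have "w y \<ge> m * (E y - R)" using f0 by (fastforce simp: f_def algebra_simps)
    moreover have "E y = R * exp (\<alpha> * r\<^sup>2 * (2 * t - t\<^sup>2))"
      unfolding E_norm ny R_def exp_add[symmetric] by (simp add: power2_eq_square algebra_simps)
    moreover have "1 + \<alpha> * r\<^sup>2 * t \<le> exp (\<alpha> * r\<^sup>2 * (2 * t - t\<^sup>2))"
    proof -
      have "t * t \<le> t" using t mult_left_le[of t t] by auto
      then have "\<alpha> * r\<^sup>2 * t \<le> \<alpha> * r\<^sup>2 * (2 * t - t\<^sup>2)"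
        using \<alpha>1 by (intro mult_left_mono) (auto simp: power2_eq_square)
      then show ?thesis using exp_ge_add_one_self[of "\<alpha> * r\<^sup>2 * (2 * t - t\<^sup>2)"] by linarith
    qed
    then have "m * R * (1 + \<alpha> * r\<^sup>2 * t) \<le> m * R * exp (\<alpha> * r\<^sup>2 * (2 * t - t\<^sup>2))"
      using m by (intro mult_left_mono) (auto simp: R_def)
    ultimately show "m * R * \<alpha> * r\<^sup>2 * t \<le> w (p + t *\<^sub>R (c - p))"
      unfolding y_def[symmetric] by (simp add: algebra_simps)
  qed
qed

text \<open>Unlike the gradient, this one-sided difference quotient makes sense at boundary points
  without any extension of the function beyond the closure.\<close>

definition flat_along :: "('a::real_normed_vector \<Rightarrow> real) \<Rightarrow> 'a \<Rightarrow> 'a \<Rightarrow> bool" where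
  "flat_along f p e \<longleftrightarrow> ((\<lambda>t. (f (p + t *\<^sub>R e) - f p) / t) \<longlongrightarrow> 0) (at_right 0)"

text \<open>With \<open>w p = 0\<close>, the linear growth from \<open>hopf_lemma\<close> keeps the
  difference quotient at \<open>p\<close> above a positive constant, so it cannot tend to
  zero.\<close>

lemma hopf_not_flat:
  fixes c p :: "'a::euclidean_space"
  assumes r: "r > 0" and p: "dist c p = r" "w p = 0" and K: "K \<ge> 0"
    and w: "continuous_on (cball c r) w" "twice_diff_on w (ball c r)"
    and nonneg: "\<And>x. x \<in> cball c r \<Longrightarrow> w x \<ge> 0" and pos: "\<And>x. x \<in> ball c r \<Longrightarrow> w x > 0"
    and super: "\<And>x. x \<in> ball c r \<Longrightarrow> laplacian w x \<le> K * w x"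
  shows "\<not> flat_along w p (c - p)"
proof
  assume flat: "flat_along w p (c - p)"
  obtain \<eta> where \<eta>: "\<eta> > 0" "\<And>t. t \<in> {0..1} \<Longrightarrow> w (p + t *\<^sub>R (c - p)) \<ge> \<eta> * t"
    using hopf_lemma[OF r p(1) K w nonneg pos super] by blast
  have "\<forall>\<^sub>F t in at_right 0. (w (p + t *\<^sub>R (c - p)) - w p) / t < \<eta>"
    using order_tendstoD(2)[OF flat[unfolded flat_along_def] \<eta>(1)] .
  moreover have "\<forall>\<^sub>F t in at_right 0. t \<in> {0<..<1::real}"
    by (rule eventually_at_right_real) simp
  ultimately have "\<forall>\<^sub>F t in at_right (0::real). False"
  proof eventually_elim
    case (elim t)
    then show False using \<eta>(2)[of t] p(2) by (auto simp: field_simps)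
  qed
  then show False by simp
qed

section \<open>Vanishing slopes at interior minima and at Neumann boundary points\<close>

lemma flat_along_min:
  fixes p :: "'a::euclidean_space"
  assumes S: "open S" "p \<in> S" and min: "\<And>y. y \<in> S \<Longrightarrow> f p \<le> f y" and f: "f differentiable (at p)"
  shows "flat_along f p e"
proof -
  have D: "(f has_derivative (\<lambda>b. partial_deriv b f p)) (at p)"
    using has_derivative_partial_deriv[OF f] .
  have "(\<lambda>b. partial_deriv b f p) = (\<lambda>h. 0)"
    by (rule differential_zero_maxmin[OF S(2,1) D]) (use min in auto)
  then have "((\<lambda>t. f (p + t *\<^sub>R e)) has_real_derivative 0) (at 0)"
    using has_real_derivative_along_line[of f "\<lambda>h. 0" p 0 e] D by simp
  then have "((\<lambda>t. (f (p + t *\<^sub>R e) - f p) / t) \<longlongrightarrow> 0) (at 0)"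
    by (simp add: DERIV_def)
  then show ?thesis
    unfolding flat_along_def by (rule tendsto_mono[rotated]) (simp add: at_within_le_at)
qed

text \<open>The vector \<open>e\<close> runs from \<open>p\<close> to the centre of a ball inside
  the domain; taking \<open>norm e\<close> as radius puts \<open>p\<close> on its sphere, the
  configuration of the Hopf lemma.\<close>

definition inward :: "'a::euclidean_space set \<Rightarrow> 'a \<Rightarrow> 'a \<Rightarrow> bool" where
  "inward \<Omega> p e \<longleftrightarrow> e \<noteq> 0 \<and> ball (p + e) (norm e) \<subseteq> \<Omega>"

text \<open>By the triangle inequality the scaled ball lies in the original one, touching it at
  \<open>p\<close>. Thus the ball can be moved into any neighbourhood of \<open>p\<close> where the
  sign of a Laplacian is known.\<close>

lemma inward_shrink:
  assumes "inward \<Omega> p e" "0 < s" "s \<le> 1"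
  shows "inward \<Omega> p (s *\<^sub>R e)"
proof -
  have "ball (p + s *\<^sub>R e) (norm (s *\<^sub>R e)) \<subseteq> ball (p + e) (norm e)"
  proof
    fix x assume "x \<in> ball (p + s *\<^sub>R e) (norm (s *\<^sub>R e))"
    then have 1: "norm (p + s *\<^sub>R e - x) < s * norm e" using assms by (simp add: dist_norm)
    have "p + e - x = (p + s *\<^sub>R e - x) + (1 - s) *\<^sub>R e" by (simp add: algebra_simps)
    then have "norm (p + e - x) \<le> norm (p + s *\<^sub>R e - x) + (1 - s) * norm e"
      using norm_triangle_ineq[of "p + s *\<^sub>R e - x" "(1 - s) *\<^sub>R e"] assms(3)
      by (simp only: norm_scaleR abs_of_nonneg diff_ge_0_iff_ge)
    with 1 show "x \<in> ball (p + e) (norm e)" by (simp add: dist_norm algebra_simps)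
  qed
  then show ?thesis using assms by (auto simp: inward_def)
qed

lemma inward_segment:
  assumes "inward \<Omega> p e" "0 < t" "t \<le> 1"
  shows "p + t *\<^sub>R e \<in> \<Omega>"
proof -
  have "p + e - (p + t *\<^sub>R e) = (1 - t) *\<^sub>R e" by (simp add: algebra_simps)
  then have "dist (p + e) (p + t *\<^sub>R e) = (1 - t) * norm e" using assms by (simp add: dist_norm)
  also have "\<dots> < norm e" using assms by (auto simp: inward_def mult_less_cancel_right1)
  finally show ?thesis using assms(1) by (auto simp: inward_def)
qed

lemma interior_ball_inward:
  assumes "open \<Omega>" "p \<in> frontier \<Omega>" "interior_ball_condition \<Omega> p"
  obtains e where "inward \<Omega> p e"
proof -
  obtain c r where cr: "r > 0" "ball c r \<subseteq> \<Omega>" "p \<in> sphere c r"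
    using assms(3) unfolding interior_ball_condition_def by blast
  then have "inward \<Omega> p (c - p)" by (auto simp: inward_def dist_norm)
  then show ?thesis using that by blast
qed

text \<open>The tangency of the interior ball determines the normal: the gradient of a defining function
  pairs nonpositively with every vector pointing strictly into the ball.\<close>

lemma outward_unit_normal_inward:
  assumes \<nu>: "outward_unit_normal \<Omega> p n" and e: "inward \<Omega> p e" and p: "p \<in> frontier \<Omega>"
  shows "\<exists>k. e = k *\<^sub>R n"
proof -
  obtain U g where g: "local_defining_function \<Omega> p U g" and n: "n = gradient g p /\<^sub>R norm (gradient g p)"
    using \<nu> by (auto simp: outward_unit_normal_def)
  define G where "G = gradient g p"
  have U: "open U" "p \<in> U" and G0: "G \<noteq> 0" and gneg: "\<Omega> \<inter> U = {x \<in> U. g x < 0}"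
    and gp: "g p = 0"
    using g p by (auto simp: local_defining_function_def G_def)
  have "Ck_on 1 g U" using g by (auto simp: local_defining_function_def Cinfinity_on_def)
  then have gd: "g differentiable (at p)"
    using U by (auto simp: differentiable_on_eq_differentiable_at)
  \<comment> \<open>For small \<open>t\<close> the point \<open>p + t d\<close> lies in the ball,
    because the square of \<open>norm (e - t d)\<close> is below that of \<open>norm e\<close>.
    Hence \<open>g\<close> is negative there, whereas \<open>G \<bullet> d > 0\<close> would make it
    positive.\<close>
  have le: "G \<bullet> d \<le> 0" if d: "d \<bullet> e > 0" for d
  proof (rule ccontr)
    assume "\<not> G \<bullet> d \<le> 0"
    then have pos: "G \<bullet> d > 0" by simp
    have "((\<lambda>t. g (p + t *\<^sub>R d)) has_real_derivative G \<bullet> d) (at 0)"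
      using has_real_derivative_along_line[of g "\<lambda>h. G \<bullet> h" p 0 d] has_derivative_gradient[OF gd]
      by (simp add: G_def)
    then obtain \<delta> where \<delta>: "\<delta> > 0" "\<And>h. h > 0 \<Longrightarrow> h < \<delta> \<Longrightarrow> g (p + h *\<^sub>R d) > 0"
      using DERIV_pos_inc_right[OF _ pos] gp by force
    have "((\<lambda>t. p + t *\<^sub>R d) \<longlongrightarrow> p + 0 *\<^sub>R d) (at_right 0)"
      by (intro tendsto_intros)
    then have "\<forall>\<^sub>F t in at_right 0. p + t *\<^sub>R d \<in> U"
      using U by (auto dest: topological_tendstoD)
    moreover have "((\<lambda>t. t * (d \<bullet> d)) \<longlongrightarrow> 0 * (d \<bullet> d)) (at_right 0)"
      by (intro tendsto_intros)
    then have "\<forall>\<^sub>F t in at_right 0. t * (d \<bullet> d) < 2 * (d \<bullet> e)"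
      using d by (intro order_tendstoD(2)) auto
    moreover have "\<forall>\<^sub>F t in at_right 0. t \<in> {0<..<\<delta>}"
      by (rule eventually_at_right_real) (fact \<delta>(1))
    ultimately have "\<forall>\<^sub>F t in at_right (0::real). False"
    proof eventually_elim
      case (elim t)
      have "p + e - (p + t *\<^sub>R d) = e - t *\<^sub>R d" by simp
      moreover have "(norm (e - t *\<^sub>R d))\<^sup>2 = (norm e)\<^sup>2 - t * (2 * (d \<bullet> e) - t * (d \<bullet> d))"
        by (simp add: power2_norm_eq_inner inner_diff inner_commute algebra_simps)
      moreover have "t * (2 * (d \<bullet> e) - t * (d \<bullet> d)) > 0" using elim by auto
      ultimately have "(dist (p + e) (p + t *\<^sub>R d))\<^sup>2 < (norm e)\<^sup>2" by (simp add: dist_norm)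
      then have "p + t *\<^sub>R d \<in> ball (p + e) (norm e)" by (simp add: power2_less_imp_less)
      then have "p + t *\<^sub>R d \<in> \<Omega>" using e by (auto simp: inward_def)
      then have "g (p + t *\<^sub>R d) < 0" using gneg elim by blast
      then show False using \<delta>(2)[of t] elim by auto
    qed
    then show False by simp
  qed
  have e0: "e \<bullet> e > 0" using e by (auto simp: inward_def)
  \<comment> \<open>The component of \<open>G\<close> orthogonal to \<open>e\<close>. Testing
    \<open>le\<close> with \<open>\<tau> + s e\<close> and letting \<open>s\<close> decrease to zero
    gives \<open>\<tau> \<bullet> \<tau> <= 0\<close>, so \<open>G\<close> is parallel to
    \<open>e\<close>.\<close>
  define \<tau> where "\<tau> = G - ((G \<bullet> e) / (e \<bullet> e)) *\<^sub>R e"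
  have \<tau>e: "\<tau> \<bullet> e = 0" using e0 by (simp add: \<tau>_def inner_diff_left)
  have "G \<bullet> \<tau> + s * (G \<bullet> e) \<le> 0" if "s > 0" for s
    using le[of "\<tau> + s *\<^sub>R e"] that \<tau>e e0 by (simp add: inner_add)
  then have "\<forall>\<^sub>F s in at_right 0. G \<bullet> \<tau> + s * (G \<bullet> e) \<le> 0"
    by (auto simp: eventually_at_right_field intro: exI[of _ 1])
  moreover have "((\<lambda>s. G \<bullet> \<tau> + s * (G \<bullet> e)) \<longlongrightarrow> G \<bullet> \<tau> + 0 * (G \<bullet> e)) (at_right 0)"
    by (intro tendsto_intros)
  ultimately have "G \<bullet> \<tau> + 0 * (G \<bullet> e) \<le> 0"
    by (intro tendsto_upperbound[of _ _ "at_right (0::real)"]) auto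
  moreover have "G \<bullet> \<tau> = \<tau> \<bullet> \<tau>"
    using \<tau>e by (subst (2) \<tau>_def) (simp add: inner_diff inner_commute)
  ultimately have "\<tau> = 0" using inner_ge_zero[of \<tau>] by simp
  then have G: "G = ((G \<bullet> e) / (e \<bullet> e)) *\<^sub>R e" by (simp add: \<tau>_def)
  then have "G \<bullet> e \<noteq> 0" using G0 by auto
  then have "e = ((e \<bullet> e) / (G \<bullet> e)) *\<^sub>R G" using e0 arg_cong[OF G, of "\<lambda>y. ((e \<bullet> e) / (G \<bullet> e)) *\<^sub>R y"] by simp
  also have "G = norm G *\<^sub>R n" using G0 by (simp add: n G_def)
  finally show ?thesis by (metis scaleR_scaleR)
qed

text \<open>The mean value theorem on the segment from \<open>p\<close> turns the difference
  quotient into \<open>gradient u \<bullet> e\<close> at an interior point. This tends to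
  \<open>G p \<bullet> e\<close>, which is zero because \<open>e\<close> is a multiple of the
  normal.\<close>

lemma neumann_flat:
  assumes \<Omega>: "open \<Omega>" and p: "p \<in> frontier \<Omega>" and u: "C1_closure u \<Omega>"
    and \<nu>: "outward_unit_normal \<Omega> p (\<nu> p)" and N: "normal_deriv \<Omega> \<nu> u p = 0"
    and e: "inward \<Omega> p e"
  shows "flat_along u p e"
proof -
  obtain G where G: "continuous_on (closure \<Omega>) G" "\<And>x. x \<in> \<Omega> \<Longrightarrow> G x = gradient u x"
    using u by (auto simp: C1_closure_def)
  have cont: "continuous_on (closure \<Omega>) u" and ud: "\<And>x. x \<in> \<Omega> \<Longrightarrow> u differentiable (at x)"
    using u \<Omega> by (auto simp: C1_closure_def differentiable_on_eq_differentiable_at)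
  have pcl: "p \<in> closure \<Omega>" "p \<notin> \<Omega>" using p \<Omega> by (auto simp: frontier_def interior_open)
  then have "p islimpt \<Omega>" by (auto simp: closure_def)
  \<comment> \<open>A nontrivial filter makes the limit unique, so the \<open>Lim\<close> inside
    \<open>normal_deriv\<close> really is \<open>G p\<close>.\<close>
  then have nt: "at p within \<Omega> \<noteq> bot" by (simp add: trivial_limit_within)
  have "(G \<longlongrightarrow> G p) (at p within \<Omega>)"
    using G(1) pcl(1) closure_subset by (meson continuous_on_def tendsto_within_subset)
  then have lim: "(gradient u \<longlongrightarrow> G p) (at p within \<Omega>)"
    by (rule Lim_transform_eventually) (auto simp: eventually_at_filter G(2))
  have "G p \<bullet> \<nu> p = 0" using N tendsto_Lim[OF nt lim] by (simp add: normal_deriv_def)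
  moreover obtain k where "e = k *\<^sub>R \<nu> p" using outward_unit_normal_inward[OF \<nu> e p] by blast
  ultimately have "((\<lambda>x. gradient u x \<bullet> e) \<longlongrightarrow> 0) (at p within \<Omega>)"
    using tendsto_inner[OF lim tendsto_const[of e]] by simp
  moreover have seg: "filterlim (\<lambda>t. p + t *\<^sub>R e) (at p within \<Omega>) (at_right 0)"
    unfolding filterlim_at
  proof
    have "\<forall>\<^sub>F t in at_right 0. t \<in> {0<..<1::real}"
      by (rule eventually_at_right_real) simp
    then show "\<forall>\<^sub>F t in at_right 0. p + t *\<^sub>R e \<in> \<Omega> \<and> p + t *\<^sub>R e \<noteq> p"
      by eventually_elim (use inward_segment[OF e] e in \<open>auto simp: inward_def\<close>)
    have "((\<lambda>t. p + t *\<^sub>R e) \<longlongrightarrow> p + 0 *\<^sub>R e) (at_right 0)" by (intro tendsto_intros)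
    then show "((\<lambda>t. p + t *\<^sub>R e) \<longlongrightarrow> p) (at_right 0)" by simp
  qed
  ultimately have lim0: "((\<lambda>t. gradient u (p + t *\<^sub>R e) \<bullet> e) \<longlongrightarrow> 0) (at_right 0)"
    by (rule filterlim_compose)
  show ?thesis
    unfolding flat_along_def
  proof (rule tendstoI)
    fix \<epsilon> :: real assume \<epsilon>: "\<epsilon> > 0"
    have "\<forall>\<^sub>F t in at_right 0. \<bar>gradient u (p + t *\<^sub>R e) \<bullet> e\<bar> < \<epsilon>"
      using tendstoD[OF lim0 \<epsilon>] by simp
    then obtain \<delta> where \<delta>: "\<delta> > 0" "\<And>t. t > 0 \<Longrightarrow> t < \<delta> \<Longrightarrow> \<bar>gradient u (p + t *\<^sub>R e) \<bullet> e\<bar> < \<epsilon>"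
      by (auto simp: eventually_at_right_field)
    have "\<forall>\<^sub>F t in at_right 0. t \<in> {0<..<min \<delta> 1}"
      by (rule eventually_at_right_real) (use \<delta> in simp)
    then show "\<forall>\<^sub>F t in at_right 0. dist ((u (p + t *\<^sub>R e) - u p) / t) 0 < \<epsilon>"
    proof eventually_elim
      case (elim t)
      let ?g = "\<lambda>t. u (p + t *\<^sub>R e)"
      have "\<exists>z>0. z < t \<and> ?g t - ?g 0 = t * (gradient u (p + z *\<^sub>R e) \<bullet> e)"
      proof -
        have "continuous_on {0..t} ?g"
        proof (rule continuous_on_compose2[OF cont])
          show "(\<lambda>t. p + t *\<^sub>R e) ` {0..t} \<subseteq> closure \<Omega>"
          proof
            fix y assume "y \<in> (\<lambda>t. p + t *\<^sub>R e) ` {0..t}"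
            then obtain s where s: "0 \<le> s" "s \<le> t" "y = p + s *\<^sub>R e" by auto
            show "y \<in> closure \<Omega>"
            proof (cases "s = 0")
              case False
              then have "y \<in> \<Omega>" using inward_segment[OF e, of s] s elim by auto
              then show ?thesis using closure_subset by blast
            qed (use s pcl in auto)
          qed
        qed (auto intro!: continuous_intros)
        moreover have "(?g has_real_derivative gradient u (p + z *\<^sub>R e) \<bullet> e) (at z)"
          if "0 < z" "z < t" for z
          by (rule has_real_derivative_along_line, rule has_derivative_gradient, rule ud)
             (use that elim inward_segment[OF e, of z] in auto)
        ultimately show ?thesis
          using MVT[of 0 t ?g] elim
          by (smt (verit) DERIV_unique diff_zero greaterThanLessThan_iff real_differentiable_def)
      qed
      then obtain z where z: "0 < z" "z < t" "?g t - ?g 0 = t * (gradient u (p + z *\<^sub>R e) \<bullet> e)"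
        by blast
      then have "(?g t - u p) / t = gradient u (p + z *\<^sub>R e) \<bullet> e" using elim by simp
      then show ?case using \<delta>(2)[of z] z elim by auto
    qed
  qed
qed

text \<open>The difference quotient of the quadratic is that of \<open>u\<close> times
  \<open>d + a * (u (p + t e) + u p)\<close>, and the second factor converges.\<close>

lemma flat_along_quadratic:
  assumes "flat_along u p e" and "((\<lambda>t. u (p + t *\<^sub>R e)) \<longlongrightarrow> u p) (at_right 0)"
  shows "flat_along (\<lambda>x. (d + a * u x) * u x) p e"
proof -
  have "((\<lambda>t. (u (p + t *\<^sub>R e) - u p) / t * (d + a * (u (p + t *\<^sub>R e) + u p)))
      \<longlongrightarrow> 0 * (d + a * (u p + u p))) (at_right 0)"
    by (intro tendsto_intros assms assms(1)[unfolded flat_along_def])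
  then show ?thesis
    unfolding flat_along_def
    by (rule_tac Lim_transform_eventually) (auto simp: algebra_simps diff_divide_distrib add_divide_distrib)
qed

section \<open>Minimum principles on the domain\<close>

lemma inward_cball_subset:
  assumes "inward \<Omega> p e"
  shows "cball (p + e) (norm e) \<subseteq> closure \<Omega>"
proof -
  have "closure (ball (p + e) (norm e)) \<subseteq> closure \<Omega>"
    using assms by (intro closure_mono) (auto simp: inward_def)
  then show ?thesis using assms by (simp add: inward_def)
qed

text \<open>By connectedness a proper nonempty zero set, relatively closed in the domain, is not
  open. A ball of positivity then touches it at some \<open>q\<close>, where the Hopf lemma demands
  a positive slope although \<open>q\<close> is an interior minimum.\<close>

lemma strong_minimum_principle:
  assumes \<Omega>: "open \<Omega>" "connected \<Omega>" and w: "continuous_on (closure \<Omega>) w" "twice_diff_on w \<Omega>"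
    and nonneg: "\<And>x. x \<in> closure \<Omega> \<Longrightarrow> w x \<ge> 0" and K: "K \<ge> 0"
    and super: "\<And>x. x \<in> \<Omega> \<Longrightarrow> laplacian w x \<le> K * w x"
    and nz: "x1 \<in> closure \<Omega>" "w x1 \<noteq> 0" and x: "x \<in> \<Omega>"
  shows "w x > 0"
proof (rule ccontr)
  assume "\<not> w x > 0"
  define Z where "Z = {y \<in> \<Omega>. w y = 0}"
  have wc: "continuous_on \<Omega> w" using w(1) closure_subset continuous_on_subset by blast
  have xZ: "x \<in> Z"
    using \<open>\<not> w x > 0\<close> nonneg[of x] x closure_subset[of \<Omega>] by (auto simp: Z_def)
  have "\<exists>y\<in>\<Omega>. w y \<noteq> 0"
  proof (rule ccontr)
    assume "\<not> ?thesis"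
    then have "w x1 = 0" using continuous_constant_on_closure[OF w(1), of 0] nz(1) by auto
    then show False using nz by simp
  qed
  then have "Z \<noteq> \<Omega>" by (auto simp: Z_def)
  have Zcl: "closedin (top_of_set \<Omega>) Z"
    unfolding Z_def by (rule continuous_closedin_preimage_constant[OF wc])
  have "\<not> openin (top_of_set \<Omega>) Z"
    using \<Omega>(2) Zcl xZ \<open>Z \<noteq> \<Omega>\<close> by (auto simp: connected_clopen)
  then have "\<not> open Z" by (metis Z_def inf.absorb_iff2 mem_Collect_eq openin_open subsetI)
  then obtain z where z: "z \<in> Z" "\<And>\<epsilon>. \<epsilon> > 0 \<Longrightarrow> \<not> ball z \<epsilon> \<subseteq> Z"
    by (meson open_contains_ball)
  obtain \<rho> where \<rho>: "\<rho> > 0" "ball z \<rho> \<subseteq> \<Omega>"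
    using z(1) \<Omega>(1) by (auto simp: Z_def open_contains_ball)
  \<comment> \<open>A quarter of \<open>\<rho>\<close> suffices: the touching ball about
    \<open>c\<close> also has radius below \<open>\<rho> / 4\<close>, so it stays within
    \<open>\<rho> / 2\<close> of \<open>z\<close>.\<close>
  obtain c where c: "dist z c < \<rho> / 4" "c \<notin> Z" using z(2)[of "\<rho> / 4"] \<rho>(1) by (meson mem_ball subsetI zero_less_divide_iff zero_less_numeral)
  \<comment> \<open>\<open>Z\<close> is closed only relative to the domain; cutting with a closed
    ball inside the domain gives a closed set, in which a point nearest to \<open>c\<close>
    exists.\<close>
  define T where "T = Z \<inter> cball z (\<rho> / 2)"
  have "T = cball z (\<rho> / 2) \<inter> {y \<in> cball z (\<rho> / 2). w y = 0}"
    using \<rho> by (auto simp: T_def Z_def)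
  moreover have "closed {y \<in> cball z (\<rho> / 2). w y = 0}"
    by (rule continuous_closed_preimage_constant)
       (use \<rho> in \<open>auto intro!: continuous_on_subset[OF wc]\<close>)
  ultimately have "closed T" by auto
  moreover have zT: "z \<in> T" using z(1) \<rho>(1) by (auto simp: T_def)
  ultimately obtain q where q: "q \<in> T" "\<And>y. y \<in> T \<Longrightarrow> dist c q \<le> dist c y"
    using distance_attains_inf[of T c] by blast
  define r where "r = dist c q"
  have r4: "r < \<rho> / 4" using q(2)[OF zT] c(1) by (simp add: r_def dist_commute)
  have r0: "r > 0" using q(1) c(2) by (auto simp: r_def T_def)
  have sub: "cball c r \<subseteq> cball z (\<rho> / 2)"
  proof
    fix y assume "y \<in> cball c r"
    then show "y \<in> cball z (\<rho> / 2)"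
      using dist_triangle[of z y c] c(1) r4 by auto
  qed
  also have "\<dots> \<subseteq> \<Omega>" using \<rho> by auto
  finally have sub\<Omega>: "cball c r \<subseteq> \<Omega>" .
  have nonneg': "w y \<ge> 0" if "y \<in> \<Omega>" for y using nonneg that closure_subset by blast
  have q0: "q \<in> \<Omega>" "w q = 0" using q(1) by (auto simp: T_def Z_def)
  have "\<not> flat_along w q (c - q)"
  proof (rule hopf_not_flat[where w=w])
    show "w y > 0" if "y \<in> ball c r" for y
    proof -
      have y: "y \<in> \<Omega>" "y \<in> cball z (\<rho> / 2)"
        using that sub sub\<Omega> ball_subset_cball by blast+
      then have "y \<notin> T" using q(2)[of y] that by (auto simp: r_def)
      then show ?thesis using y nonneg'[of y] by (auto simp: T_def Z_def less_le)
    qed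
    show "twice_diff_on w (ball c r)" by (rule twice_diff_on_subset[OF w(2)]) (use sub\<Omega> in auto)
    show "laplacian w y \<le> K * w y" if "y \<in> ball c r" for y using super sub\<Omega> that ball_subset_cball by blast
  qed (use r0 K q0 sub\<Omega> nonneg' continuous_on_subset[OF wc] r_def in auto)
  moreover have "flat_along w q (c - q)"
    by (rule flat_along_min[OF \<Omega>(1) q0(1)])
       (use w(2) nonneg' q0 in \<open>auto simp: twice_diff_on_def\<close>)
  ultimately show False by simp
qed

text \<open>A zero at \<open>p\<close> would make the interior ball given by \<open>e\<close> a Hopf
  configuration, contradicting the vanishing slope along \<open>e\<close>.\<close>

lemma positive_up_to_boundary:
  assumes w: "continuous_on (closure \<Omega>) w" "twice_diff_on w \<Omega>"
    and pos: "\<And>x. x \<in> \<Omega> \<Longrightarrow> w x > 0" and nonneg: "\<And>x. x \<in> closure \<Omega> \<Longrightarrow> w x \<ge> 0" and K: "K \<ge> 0"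
    and super: "\<And>x. x \<in> \<Omega> \<Longrightarrow> laplacian w x \<le> K * w x"
    and e: "inward \<Omega> p e" and flat: "flat_along w p e"
  shows "w p \<noteq> 0"
proof
  assume p0: "w p = 0"
  have sub: "ball (p + e) (norm e) \<subseteq> \<Omega>" and e0: "norm e > 0" using e by (auto simp: inward_def)
  note cl = inward_cball_subset[OF e]
  have "\<not> flat_along w p ((p + e) - p)"
  proof (rule hopf_not_flat[where w=w and r="norm e"])
    show "twice_diff_on w (ball (p + e) (norm e))" by (rule twice_diff_on_subset[OF w(2) sub])
    show "continuous_on (cball (p + e) (norm e)) w" by (rule continuous_on_subset[OF w(1) cl])
    show "dist (p + e) p = norm e" by (simp add: dist_norm)
  qed (use K p0 sub cl e0 pos nonneg super in blast)+
  then show False using flat by simp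
qed

text \<open>A function that is strictly superharmonic near \<open>p\<close> has no interior minimum near \<open>p\<close>, so
  the Hopf lemma applies on a small interior ball touching \<open>p\<close>.\<close>

lemma minimum_not_strictly_superharmonic:
  assumes \<Omega>: "open \<Omega>" and w: "continuous_on (closure \<Omega>) w" "twice_diff_on w \<Omega>"
    and p: "p \<in> closure \<Omega>" and min: "\<And>x. x \<in> closure \<Omega> \<Longrightarrow> w p \<le> w x"
    and \<delta>: "\<delta> > 0" and super: "\<And>x. x \<in> \<Omega> \<Longrightarrow> dist p x < \<delta> \<Longrightarrow> laplacian w x < 0"
    and bd: "p \<notin> \<Omega> \<Longrightarrow> \<exists>e. inward \<Omega> p e \<and> (\<forall>s. 0 < s \<longrightarrow> s \<le> 1 \<longrightarrow> flat_along w p (s *\<^sub>R e))"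
  shows False
proof -
  have min': "w p \<le> w y" if "y \<in> \<Omega>" for y using min that closure_subset by blast
  have inner: "w x \<noteq> w p" if x: "x \<in> \<Omega>" "dist p x < \<delta>" for x
  proof
    assume "w x = w p"
    then have "laplacian w x \<ge> 0"
      using laplacian_nonneg_at_min[OF \<Omega> x(1) w(2)] min' by auto
    then show False using super[OF x] by simp
  qed
  have "p \<notin> \<Omega>" using inner[of p] \<delta> by auto
  then obtain e' where e': "inward \<Omega> p e'" "\<And>s. 0 < s \<Longrightarrow> s \<le> 1 \<Longrightarrow> flat_along w p (s *\<^sub>R e')"
    using bd by blast
  \<comment> \<open>The shrunken ball has diameter at most \<open>\<delta> / 2\<close>, hence lies
    in the region where the Laplacian is negative.\<close>
  define s where "s = min 1 (\<delta> / (4 * norm e'))"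
  have e'0: "norm e' > 0" using e' by (auto simp: inward_def)
  have s: "0 < s" "s \<le> 1" "s * norm e' \<le> \<delta> / 4"
    using \<delta> e'0 by (auto simp: s_def min_def field_simps)
  define e where "e = s *\<^sub>R e'"
  have e: "inward \<Omega> p e" "flat_along w p e" "norm e \<le> \<delta> / 4"
    using inward_shrink[OF e'(1)] e'(2) s by (auto simp: e_def)
  \<comment> \<open>Subtracting \<open>w p\<close> makes the value at the touching point zero, as
    the Hopf lemma requires.\<close>
  define h where "h x = (- w p) + 1 * w x + 0 * w x" for x
  have h2: "twice_diff_on h \<Omega>" and lap: "x \<in> \<Omega> \<Longrightarrow> laplacian h x = laplacian w x" for x
    using twice_diff_on_lincomb[OF \<Omega> w(2) w(2), where l="- w p" and j=1 and k=0] unfolding h_def by auto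
  have sub: "ball (p + e) (norm e) \<subseteq> \<Omega>" and e0: "norm e > 0" using e by (auto simp: inward_def)
  have near: "dist p x < \<delta>" if "x \<in> ball (p + e) (norm e)" for x
  proof -
    have "dist p x \<le> dist p (p + e) + dist (p + e) x" by (rule dist_triangle)
    then show ?thesis using that e(3) \<delta> by (simp add: dist_norm)
  qed
  note cl = inward_cball_subset[OF e(1)]
  have "\<not> flat_along h p ((p + e) - p)"
  proof (rule hopf_not_flat[where w=h and r="norm e" and K=0])
    show "twice_diff_on h (ball (p + e) (norm e))" by (rule twice_diff_on_subset[OF h2 sub])
    show "continuous_on (cball (p + e) (norm e)) h"
      unfolding h_def by (intro continuous_intros continuous_on_subset[OF w(1) cl])
    show "dist (p + e) p = norm e" by (simp add: dist_norm)
    show "h x \<ge> 0" if "x \<in> cball (p + e) (norm e)" for x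
      using min[of x] cl that by (auto simp: h_def)
    fix x assume x: "x \<in> ball (p + e) (norm e)"
    then have "x \<in> \<Omega>" using sub by blast
    then show "h x > 0" "laplacian h x \<le> 0 * h x"
      using inner[of x] near[OF x] min'[of x] lap[of x] super[of x] by (auto simp: h_def)
  qed (use e0 in \<open>auto simp: h_def\<close>)
  moreover have "flat_along h p e" using e(2) by (simp add: flat_along_def h_def)
  ultimately show False by simp
qed

section \<open>One species with a continuous growth factor and Neumann data\<close>

locale neumann_species =
  fixes \<Omega> :: "'a::euclidean_space set" and \<nu> :: "'a \<Rightarrow> 'a" and u q :: "'a \<Rightarrow> real" and d a :: real
  assumes domain: "bounded_smooth_domain \<Omega>"
    and ball: "\<forall>p\<in>frontier \<Omega>. interior_ball_condition \<Omega> p"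
    and normal: "\<forall>p\<in>frontier \<Omega>. outward_unit_normal \<Omega> p (\<nu> p)"
    and d: "d > 0" and a: "a \<ge> 0"
    and C1: "C1_closure u \<Omega>" and C2: "Ck_on 2 u \<Omega>"
    and nonneg: "\<And>x. x \<in> closure \<Omega> \<Longrightarrow> u x \<ge> 0"
    and q: "continuous_on (closure \<Omega>) q"
    and equation: "\<And>x. x \<in> \<Omega> \<Longrightarrow> laplacian (\<lambda>y. (d + a * u y) * u y) x + u x * q x = 0"
    and neumann: "\<And>p. p \<in> frontier \<Omega> \<Longrightarrow> normal_deriv \<Omega> \<nu> u p = 0"
begin

definition W :: "'a \<Rightarrow> real" where "W x = (d + a * u x) * u x"

lemma \<Omega>: "open \<Omega>" "connected \<Omega>" "compact (closure \<Omega>)" "closure \<Omega> \<noteq> {}"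
  using domain by (auto simp: bounded_smooth_domain_def)

lemma cont_u: "continuous_on (closure \<Omega>) u"
  using C1 by (simp add: C1_closure_def)

lemma cont_W: "continuous_on (closure \<Omega>) W"
  unfolding W_def by (intro continuous_intros cont_u)

lemma W2: "twice_diff_on W \<Omega>"
  using twice_diff_on_quadratic[OF \<Omega>(1) Ck_on_2_imp_twice_diff_on[OF C2 \<Omega>(1)], of d a]
  by (simp add: W_def[abs_def])

lemma laplacian_W: "x \<in> \<Omega> \<Longrightarrow> laplacian W x = - u x * q x"
  using equation[of x] by (simp add: W_def[abs_def])

text \<open>Extrema of \<open>u\<close> are thereby extrema of \<open>W\<close>, the function to
  which the minimum principles apply.\<close>

lemma W_mono:
  assumes "x \<in> closure \<Omega>" "y \<in> closure \<Omega>" "u x \<le> u y"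
  shows "W x \<le> W y"
  unfolding W_def using assms nonneg d a by (intro mult_mono) (auto intro!: mult_left_mono)

text \<open>All scalings of \<open>e\<close> are covered because the minimum argument passes to a
  smaller touching ball.\<close>

lemma boundary_flat:
  assumes "p \<in> closure \<Omega>" "p \<notin> \<Omega>"
  shows "\<exists>e. inward \<Omega> p e \<and> (\<forall>s. 0 < s \<longrightarrow> s \<le> 1 \<longrightarrow> flat_along W p (s *\<^sub>R e))"
proof -
  have p: "p \<in> frontier \<Omega>" using assms \<Omega>(1) by (simp add: frontier_def interior_open)
  obtain e where e: "inward \<Omega> p e" using interior_ball_inward[OF \<Omega>(1) p] ball p by blast
  have "flat_along W p (s *\<^sub>R e)" if s: "0 < s" "s \<le> 1" for s
  proof -
    note es = inward_shrink[OF e s]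
    have "flat_along u p (s *\<^sub>R e)"
      using neumann_flat[OF \<Omega>(1) p C1 _ neumann[OF p] es] normal p by blast
    moreover have "((\<lambda>t. u (p + t *\<^sub>R (s *\<^sub>R e))) \<longlongrightarrow> u p) (at_right 0)"
    proof (rule continuous_on_tendsto_compose[OF cont_u _ assms(1)])
      have "((\<lambda>t. p + t *\<^sub>R (s *\<^sub>R e)) \<longlongrightarrow> p + 0 *\<^sub>R (s *\<^sub>R e)) (at_right 0)"
        by (intro tendsto_intros)
      then show "((\<lambda>t. p + t *\<^sub>R (s *\<^sub>R e)) \<longlongrightarrow> p) (at_right 0)" by simp
      have "\<forall>\<^sub>F t in at_right 0. t \<in> {0<..<1::real}"
        by (rule eventually_at_right_real) simp
      then show "\<forall>\<^sub>F t in at_right 0. p + t *\<^sub>R (s *\<^sub>R e) \<in> closure \<Omega>"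
        by eventually_elim
           (use inward_segment[OF es] closure_subset[of \<Omega>] in \<open>auto simp del: scaleR_scaleR\<close>)
    qed
    ultimately show ?thesis
      unfolding W_def[abs_def] by (rule flat_along_quadratic)
  qed
  then show ?thesis using e by blast
qed

text \<open>A bound \<open>Q\<close> for the growth factor on the compact closure and
  \<open>d * u <= W\<close> give a Laplacian of \<open>W\<close> at most \<open>Q / d * W\<close>,
  whatever the sign of \<open>q\<close>. The strong minimum principle handles the interior, the Hopf
  lemma the boundary.\<close>

lemma positive:
  assumes nz: "\<exists>x\<in>closure \<Omega>. u x \<noteq> 0" and x: "x \<in> closure \<Omega>"
  shows "u x > 0"
proof -
  have "\<exists>z\<in>closure \<Omega>. \<forall>y\<in>closure \<Omega>. \<bar>q y\<bar> \<le> \<bar>q z\<bar>"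
    by (rule continuous_attains_sup) (use \<Omega> q in \<open>auto intro: continuous_intros\<close>)
  then obtain Q where Q: "Q \<ge> 0" "\<And>y. y \<in> closure \<Omega> \<Longrightarrow> \<bar>q y\<bar> \<le> Q"
    using abs_ge_zero by blast
  have K: "Q / d \<ge> 0" using Q d by simp
  have Wn: "W y \<ge> 0" if "y \<in> closure \<Omega>" for y
    using nonneg[OF that] d a by (simp add: W_def)
  have W0: "W y = 0 \<longleftrightarrow> u y = 0" if "y \<in> closure \<Omega>" for y
    using nonneg[OF that] d a by (auto simp: W_def add_pos_nonneg less_imp_neq[symmetric])
  have super: "laplacian W y \<le> Q / d * W y" if y: "y \<in> \<Omega>" for y
  proof -
    have yc: "y \<in> closure \<Omega>" using y closure_subset by blast
    have "- u y * q y \<le> u y * Q"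
      using mult_left_mono[of "- q y" Q "u y"] Q(2)[OF yc] nonneg[OF yc] by auto
    also have "\<dots> = Q / d * (d * u y)" using d by simp
    also have "\<dots> \<le> Q / d * W y"
      using K a nonneg[OF yc] by (intro mult_left_mono) (auto simp: W_def algebra_simps)
    finally show ?thesis using laplacian_W[OF y] by simp
  qed
  obtain x1 where x1: "x1 \<in> closure \<Omega>" "W x1 \<noteq> 0" using nz W0 by blast
  have int: "W y > 0" if "y \<in> \<Omega>" for y
    by (rule strong_minimum_principle[OF \<Omega>(1,2) cont_W W2 Wn K super x1 that])
  have "W x \<noteq> 0"
  proof (cases "x \<in> \<Omega>")
    case True
    then show ?thesis using int[of x] by simp
  next
    case False
    obtain e where e: "inward \<Omega> x e" "\<And>s. 0 < s \<Longrightarrow> s \<le> 1 \<Longrightarrow> flat_along W x (s *\<^sub>R e)"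
      using boundary_flat[OF x False] by blast
    show ?thesis
      by (rule positive_up_to_boundary[OF cont_W W2 int Wn K super e(1)]) (use e(2)[of 1] in auto)
  qed
  then show ?thesis using W0[OF x] nonneg[OF x] by simp
qed

text \<open>By continuity the reaction term keeps its sign near \<open>p\<close>; the factor
  \<open>s\<close>, taken as 1 or -1, serves minima and maxima alike.\<close>

lemma eventually_near:
  assumes p: "p \<in> closure \<Omega>" and up: "u p > 0" and s: "s * q p > 0"
  obtains \<delta> where "\<delta> > 0" "\<And>x. x \<in> \<Omega> \<Longrightarrow> dist p x < \<delta> \<Longrightarrow> s * (u x * q x) > 0"
proof -
  have "continuous_on (closure \<Omega>) (\<lambda>x. s * (u x * q x))"
    by (intro continuous_intros cont_u q)
  moreover have pos: "s * (u p * q p) > 0"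
    using mult_pos_pos[OF up s] by (simp add: mult.left_commute)
  ultimately obtain \<delta> where "\<delta> > 0"
    "\<And>x. x \<in> closure \<Omega> \<Longrightarrow> dist x p < \<delta> \<Longrightarrow> dist (s * (u x * q x)) (s * (u p * q p)) < s * (u p * q p)"
    using p unfolding continuous_on_iff by metis
  moreover have "y > 0" if "dist y z < z" for y z :: real
    using that by (auto simp: dist_real_def)
  ultimately show ?thesis
    using that[of \<delta>] closure_subset[of \<Omega>] by (metis dist_commute subsetD)
qed

text \<open>If \<open>q p\<close> were positive, \<open>W\<close> would be strictly superharmonic
  near its own minimum \<open>p\<close>.\<close>

lemma factor_nonpos_at_min:
  assumes p: "p \<in> closure \<Omega>" "u p > 0" and min: "\<And>x. x \<in> closure \<Omega> \<Longrightarrow> u p \<le> u x"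
  shows "q p \<le> 0"
proof (rule ccontr)
  assume "\<not> q p \<le> 0"
  then obtain \<delta> where \<delta>: "\<delta> > 0" "\<And>x. x \<in> \<Omega> \<Longrightarrow> dist p x < \<delta> \<Longrightarrow> 1 * (u x * q x) > 0"
    using eventually_near[OF p, of 1] by auto
  show False
    by (rule minimum_not_strictly_superharmonic[OF \<Omega>(1) cont_W W2 p(1) _ \<delta>(1) _ boundary_flat[OF p(1)]])
       (use \<delta>(2) laplacian_W W_mono[OF p(1)] min in auto)
qed

lemma factor_nonneg_at_max:
  assumes p: "p \<in> closure \<Omega>" "u p > 0" and max: "\<And>x. x \<in> closure \<Omega> \<Longrightarrow> u x \<le> u p"
  shows "q p \<ge> 0"
proof (rule ccontr)
  assume "\<not> q p \<ge> 0"
  then obtain \<delta> where \<delta>: "\<delta> > 0" "\<And>x. x \<in> \<Omega> \<Longrightarrow> dist p x < \<delta> \<Longrightarrow> - 1 * (u x * q x) > 0"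
    using eventually_near[OF p, of "- 1"] by auto
  \<comment> \<open>The negative of \<open>W\<close>: a negative \<open>q p\<close> makes it
    strictly superharmonic near \<open>p\<close>, where it attains its minimum.\<close>
  define V where "V x = 0 + (- 1) * W x + 0 * W x" for x
  have V2: "twice_diff_on V \<Omega>" and lap: "\<And>x. x \<in> \<Omega> \<Longrightarrow> laplacian V x = u x * q x"
    using twice_diff_on_lincomb[OF \<Omega>(1) W2 W2, where l=0 and j="- 1" and k=0] laplacian_W
    unfolding V_def by auto
  have contV: "continuous_on (closure \<Omega>) V"
    unfolding V_def by (intro continuous_intros cont_W)
  have V: "flat_along V p e" if "flat_along W p e" for e
    using tendsto_minus[OF that[unfolded flat_along_def]]
    by (simp add: flat_along_def V_def minus_divide_left)
  show False
  proof (rule minimum_not_strictly_superharmonic[OF \<Omega>(1) contV V2 p(1) _ \<delta>(1)])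
    show "V p \<le> V x" if "x \<in> closure \<Omega>" for x
      using W_mono[OF that p(1) max[OF that]] by (simp add: V_def)
    show "laplacian V x < 0" if "x \<in> \<Omega>" "dist p x < \<delta>" for x
      using \<delta>(2)[OF that] lap[OF that(1)] by simp
    show "\<exists>e. inward \<Omega> p e \<and> (\<forall>s. 0 < s \<longrightarrow> s \<le> 1 \<longrightarrow> flat_along V p (s *\<^sub>R e))" if "p \<notin> \<Omega>"
      using boundary_flat[OF p(1) that] V by blast
  qed
qed

lemma extrema:
  assumes "\<exists>x\<in>closure \<Omega>. u x \<noteq> 0"
  obtains x y where "x \<in> closure \<Omega>" "\<And>z. z \<in> closure \<Omega> \<Longrightarrow> u x \<le> u z" "q x \<le> 0"
    "y \<in> closure \<Omega>" "\<And>z. z \<in> closure \<Omega> \<Longrightarrow> u z \<le> u y" "q y \<ge> 0"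
proof -
  obtain x where x: "x \<in> closure \<Omega>" "\<And>z. z \<in> closure \<Omega> \<Longrightarrow> u x \<le> u z"
    using continuous_attains_inf[OF \<Omega>(3,4) cont_u] by blast
  obtain y where y: "y \<in> closure \<Omega>" "\<And>z. z \<in> closure \<Omega> \<Longrightarrow> u z \<le> u y"
    using continuous_attains_sup[OF \<Omega>(3,4) cont_u] by blast
  show ?thesis
    using that[OF x _ y] factor_nonpos_at_min[OF x(1) positive[OF assms x(1)] x(2)]
      factor_nonneg_at_max[OF y(1) positive[OF assms y(1)] y(2)] by blast
qed

end

section \<open>Combining the bounds of the two species\<close>

lemma comparison_bounds:
  fixes a b um uM vm vM :: real
  assumes "0 < a" "a < 1" "0 < b" "b < 1"
    and "uM \<le> 1 - a * vm" "1 - a * vM \<le> um" "vM \<le> 1 - b * um" "1 - b * uM \<le> vm"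
  shows "uM \<le> (1 - a) / (1 - a * b)" "(1 - a) / (1 - a * b) \<le> um"
proof -
  have ab: "a * b < 1" using assms mult_strict_mono[of a 1 b 1] by simp
  \<comment> \<open>Scaled by \<open>a\<close>, the bounds on the second species can be inserted
    into those on the first, leaving one inequality each for \<open>uM\<close> and
    \<open>um\<close>.\<close>
  have "a * (1 - b * uM) \<le> a * vm" "a * vM \<le> a * (1 - b * um)"
    using assms by (auto intro!: mult_left_mono)
  then have "uM * (1 - a * b) \<le> 1 - a" "1 - a \<le> um * (1 - a * b)"
    using assms by (auto simp: algebra_simps)
  then show "uM \<le> (1 - a) / (1 - a * b)" "(1 - a) / (1 - a * b) \<le> um"
    using ab by (auto simp: pos_le_divide_eq pos_divide_le_eq)
qed

theorem theorem4p1: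
  fixes \<Omega> :: "(real ^ 'n) set" and \<nu> :: "real ^ 'n \<Rightarrow> real ^ 'n"
    and u v :: "real ^ 'n \<Rightarrow> real"
    and d\<^sub>1 d\<^sub>2 a\<^sub>1\<^sub>1 a\<^sub>2\<^sub>2 a\<^sub>1 a\<^sub>2 :: real
  assumes "bounded_smooth_domain \<Omega>"
    and "\<forall>p\<in>frontier \<Omega>. interior_ball_condition \<Omega> p"
    and "\<forall>p\<in>frontier \<Omega>. outward_unit_normal \<Omega> p (\<nu> p)"
    and "a\<^sub>1 > 0" "a\<^sub>2 > 0" "d\<^sub>1 > 0" "d\<^sub>2 > 0" "a\<^sub>1\<^sub>1 \<ge> 0" "a\<^sub>2\<^sub>2 \<ge> 0"
    and "a\<^sub>1 < 1" "a\<^sub>2 < 1"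
    and "nonneg_classical_solution \<Omega> \<nu> d\<^sub>1 d\<^sub>2 a\<^sub>1\<^sub>1 a\<^sub>2\<^sub>2 a\<^sub>1 a\<^sub>2 u v"
    and "\<exists>x\<in>closure \<Omega>. u x \<noteq> 0" and "\<exists>x\<in>closure \<Omega>. v x \<noteq> 0"
  shows "(\<forall>x\<in>closure \<Omega>. u x = (1 - a\<^sub>1) / (1 - a\<^sub>1 * a\<^sub>2)) \<and>
         (\<forall>x\<in>closure \<Omega>. v x = (1 - a\<^sub>2) / (1 - a\<^sub>1 * a\<^sub>2))"
proof -
  note sol = assms(12)[unfolded nonneg_classical_solution_def]
  have cu: "continuous_on (closure \<Omega>) u" and cv: "continuous_on (closure \<Omega>) v"
    using sol by (auto simp: C1_closure_def)
  \<comment> \<open>The coupling enters only through the growth factor, so each species is an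
    instance of the locale with the other one absorbed into \<open>q\<close>.\<close>
  interpret U: neumann_species \<Omega> \<nu> u "\<lambda>x. 1 - u x - a\<^sub>1 * v x" d\<^sub>1 a\<^sub>1\<^sub>1
    by unfold_locales (use assms sol in \<open>auto intro!: continuous_intros cu cv\<close>)
  interpret V: neumann_species \<Omega> \<nu> v "\<lambda>x. 1 - a\<^sub>2 * u x - v x" d\<^sub>2 a\<^sub>2\<^sub>2
    by unfold_locales (use assms sol in \<open>auto intro!: continuous_intros cu cv\<close>)
  obtain x y where u: "x \<in> closure \<Omega>" "\<And>z. z \<in> closure \<Omega> \<Longrightarrow> u x \<le> u z" "1 - u x - a\<^sub>1 * v x \<le> 0"
    "y \<in> closure \<Omega>" "\<And>z. z \<in> closure \<Omega> \<Longrightarrow> u z \<le> u y" "1 - u y - a\<^sub>1 * v y \<ge> 0"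
    using U.extrema assms by blast
  obtain x' y' where v: "x' \<in> closure \<Omega>" "\<And>z. z \<in> closure \<Omega> \<Longrightarrow> v x' \<le> v z" "1 - a\<^sub>2 * u x' - v x' \<le> 0"
    "y' \<in> closure \<Omega>" "\<And>z. z \<in> closure \<Omega> \<Longrightarrow> v z \<le> v y'" "1 - a\<^sub>2 * u y' - v y' \<ge> 0"
    using V.extrema assms by blast
  \<comment> \<open>The species need not be extremal at the same points; each value at a foreign
    extremum is estimated by the minimum or maximum of its own species.\<close>
  have "a\<^sub>1 * v x' \<le> a\<^sub>1 * v y" "a\<^sub>1 * v x \<le> a\<^sub>1 * v y'" "a\<^sub>2 * u x \<le> a\<^sub>2 * u y'" "a\<^sub>2 * u x' \<le> a\<^sub>2 * u y"
    using u v assms(4,5) by (auto intro!: mult_left_mono)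
  then have ineqs: "u y \<le> 1 - a\<^sub>1 * v x'" "1 - a\<^sub>1 * v y' \<le> u x" "v y' \<le> 1 - a\<^sub>2 * u x" "1 - a\<^sub>2 * u y \<le> v x'"
    using u v by auto
  have "u y \<le> (1 - a\<^sub>1) / (1 - a\<^sub>1 * a\<^sub>2)" "(1 - a\<^sub>1) / (1 - a\<^sub>1 * a\<^sub>2) \<le> u x"
    by (rule comparison_bounds[OF assms(4,10,5,11) ineqs])+
  \<comment> \<open>The system of four inequalities is symmetric under exchanging the species, so
    the same lemma applies with the roles swapped.\<close>
  moreover have "v y' \<le> (1 - a\<^sub>2) / (1 - a\<^sub>2 * a\<^sub>1)" "(1 - a\<^sub>2) / (1 - a\<^sub>2 * a\<^sub>1) \<le> v x'"
    by (rule comparison_bounds[OF assms(5,11,4,10) ineqs(3,4,1,2)])+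
  \<comment> \<open>Each maximum lies below the claimed constant and each minimum above it, so both
    functions are constant.\<close>
  ultimately show ?thesis
    using u(2,5) v(2,5) by (force simp: mult.commute intro!: order_antisym)
qed

end
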